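(* If $G$ is a $(\mu,\mu_{\rm t})$-graph that admits a feasible $\mu_{\rm t}$-set, then $\mu(G\boxtimes P_2) \ge \mu(G) + n(G)$.
   Context: All graphs are finite, simple, undirected and connected; $n(G)$ is the number of vertices of $G$, and $P_2$ is the path on two vertices. For $X\subseteq V(G)$, two vertices $x,y\in V(G)$ are $X$-visible if there is a shortest $x,y$-path in $G$ none of whose internal vertices lies in $X$. A set $X\subseteq V(G)$ is a mutual-visibility set if its vertices are pairwise $X$-visible; $\mu(G)$ is the largest cardinality of a mutual-visibility set of $G$. A set $X\subseteq V(G)$ is a total mutual-visibility set of $G$ if every pair of vertices of $G$ is $X$-visible; $\mu_{\rm t}(G)$ is the largest cardinality of a total mutual-visibility set of $G$ (it is $0$ if there is no nonempty such set), and a $\mu_{\rm t}$-set is a total mutual-visibility set of cardinality $\mu_{\rm t}(G)$. $G$ is a $(\mu,\mu_{\rm t})$-graph if $\mu(G)=\mu_{\rm t}(G)$. A total mutual-visibility set $S$ of $G$ is feasible if any two adjacent vertices $x,y\in S$ have a common neighbor $z\notin S$. The strong product $G\boxtimes H$ has vertex set $V(G)\times V(H)$, and two distinct vertices $(g,h)$ and $(g',h')$ are adjacent iff ($g=g'$ or $gg'\in E(G)$) and ($h=h'$ or $hh'\in E(H)$). *)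

theory Defs
  imports
    "Graph_Theory.Pair_Digraph"
    "Graph_Theory.Vertex_Walk"
    "Graph_Theory.Digraph_Component"
begin

text \<open>
  A finite simple undirected graph is a \<^locale>\<open>pair_graph\<close>: a finite loop-free digraph whose
  arc relation is symmetric, so that \<^term>\<open>parcs G\<close> is the adjacency relation.  Connectedness
  in the sense of Graph Theory excludes the null graph.
\<close>

definition shortest_path :: "'a pair_pre_digraph \<Rightarrow> 'a \<Rightarrow> 'a vwalk \<Rightarrow> 'a \<Rightarrow> bool" where
  "shortest_path G x p y \<longleftrightarrow>
     vpath p (with_proj G) \<and> hd p = x \<and> last p = y \<and>
     (\<forall>q. vpath q (with_proj G) \<and> hd q = x \<and> last q = y \<longrightarrow> vwalk_length p \<le> vwalk_length q)"

definition internal_verts :: "'a vwalk \<Rightarrow> 'a set" where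
  "internal_verts p = set (butlast (tl p))"

definition visible :: "'a pair_pre_digraph \<Rightarrow> 'a set \<Rightarrow> 'a \<Rightarrow> 'a \<Rightarrow> bool" where
  "visible G X x y \<longleftrightarrow> (\<exists>p. shortest_path G x p y \<and> internal_verts p \<inter> X = {})"

definition mutual_visibility_set :: "'a pair_pre_digraph \<Rightarrow> 'a set \<Rightarrow> bool" where
  "mutual_visibility_set G X \<longleftrightarrow> X \<subseteq> pverts G \<and> pairwise (visible G X) X"

definition total_mutual_visibility_set :: "'a pair_pre_digraph \<Rightarrow> 'a set \<Rightarrow> bool" where
  "total_mutual_visibility_set G X \<longleftrightarrow> X \<subseteq> pverts G \<and> pairwise (visible G X) (pverts G)"

definition mu :: "'a pair_pre_digraph \<Rightarrow> nat" where
  "mu G = Max {card X | X. mutual_visibility_set G X}"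

text \<open>
  In a connected graph the empty set is a total mutual-visibility set, so the maximum below is
  taken over a nonempty set and is 0 if no nonempty total mutual-visibility set exists.
\<close>

definition mu_t :: "'a pair_pre_digraph \<Rightarrow> nat" where
  "mu_t G = Max {card X | X. total_mutual_visibility_set G X}"

definition mu_t_set :: "'a pair_pre_digraph \<Rightarrow> 'a set \<Rightarrow> bool" where
  "mu_t_set G X \<longleftrightarrow> total_mutual_visibility_set G X \<and> card X = mu_t G"

definition mu_mu_t_graph :: "'a pair_pre_digraph \<Rightarrow> bool" where
  "mu_mu_t_graph G \<longleftrightarrow> mu G = mu_t G"

definition feasible :: "'a pair_pre_digraph \<Rightarrow> 'a set \<Rightarrow> bool" where
  "feasible G S \<longleftrightarrow> total_mutual_visibility_set G S \<and>
     (\<forall>x\<in>S. \<forall>y\<in>S. (x, y) \<in> parcs G \<longrightarrow>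
        (\<exists>z. z \<notin> S \<and> (x, z) \<in> parcs G \<and> (y, z) \<in> parcs G))"

definition strong_product ::
  "'a pair_pre_digraph \<Rightarrow> 'b pair_pre_digraph \<Rightarrow> ('a \<times> 'b) pair_pre_digraph" where
  "strong_product G H = \<lparr>
     pverts = pverts G \<times> pverts H,
     parcs = {((g, h), (g', h')) | g h g' h'.
        (g, h) \<in> pverts G \<times> pverts H \<and> (g', h') \<in> pverts G \<times> pverts H \<and>
        (g, h) \<noteq> (g', h') \<and>
        (g = g' \<or> (g, g') \<in> parcs G) \<and> (h = h' \<or> (h, h') \<in> parcs H)} \<rparr>"

definition path_graph :: "nat \<Rightarrow> nat pair_pre_digraph" where
  "path_graph n = \<lparr>
     pverts = {..<n},
     parcs = {(i, j). i < n \<and> j < n \<and> (j = Suc i \<or> i = Suc j)} \<rparr>"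

end

theory Submission
  imports Defs
begin

text \<open>
  Let \<open>S\<close> be a \<open>\<mu>\<^sub>t\<close>-set of \<open>G\<close>.  Then \<open>S \<times> {1} \<union> V(G) \<times> {0}\<close> is a mutual-visibility set of the
  product: between vertices with distinct first coordinates \<open>g\<close> and \<open>h\<close>, take a shortest
  \<open>g,h\<close>-path of \<open>G\<close> whose internal vertices avoid \<open>S\<close> and run its internal part through the layer
  of 1.  Since walks of the product project to walks of \<open>G\<close> that are no longer, this lift is
  a shortest path.
\<close>

lemma length_vwalk_to_vpath_le: "length (vwalk_to_vpath p) \<le> length p"
proof (induct p rule: vwalk_to_vpath_induct3)
  case (in_set x xs)
  then show ?case
    using length_dropWhile_le[of "\<lambda>y. y \<noteq> x" xs] by auto
qed auto

text \<open>\<open>shortest_path\<close> compares \<open>p\<close> with paths only, whereas a path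
  of the product may project to a walk that repeats vertices. Cutting out the cycles of
  \<open>q\<close> carries the bound over to walks.\<close>

lemma shortest_path_le_vwalk:
  assumes "shortest_path G x p y"
    and "vwalk q (with_proj G)" "hd q = x" "last q = y"
  shows "vwalk_length p \<le> vwalk_length q"
proof -
  have "vwalk_length p \<le> vwalk_length (vwalk_to_vpath q)"
    using assms vwalk_to_vpath_vpath[OF assms(2)]
    by (simp add: shortest_path_def vwalk_to_vpath_hd vwalk_to_vpath_last del: vwalk_length_simp)
  also have "\<dots> \<le> vwalk_length q"
    using length_vwalk_to_vpath_le[of q] by simp
  finally show ?thesis .
qed

lemma vwalk_arcs_map: "vwalk_arcs (map f p) = map (map_prod f f) (vwalk_arcs p)"
  by (induct p rule: vwalk_arcs.induct) auto

text \<open>The vertex list of a path is distinct, so each of its arcs joins two different vertices;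
  this supplies the premise \<open>u \<noteq> v\<close> of the last assumption.\<close>

lemma vpath_map:
  assumes "vpath p (with_proj G)" and "inj_on f (set p)"
    and "f ` set p \<subseteq> pverts H"
    and "\<And>u v. u \<in> set p \<Longrightarrow> v \<in> set p \<Longrightarrow> u \<noteq> v \<Longrightarrow> (u, v) \<in> parcs G
      \<Longrightarrow> (f u, f v) \<in> parcs H"
  shows "vpath (map f p) (with_proj H)"
proof -
  have p: "distinct p" "set (vwalk_arcs p) \<subseteq> parcs G"
    using assms(1) by (auto simp: vpath_def vwalk_def)
  have "u \<in> set p \<and> v \<in> set p \<and> u \<noteq> v" if "(u, v) \<in> set (vwalk_arcs p)" for u v
    using p(1) that by (induct p rule: vwalk_arcs.induct) auto
  then have "(f u, f v) \<in> parcs H" if "(u, v) \<in> set (vwalk_arcs p)" for u v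
    using that assms(4) p(2) by (meson subsetD)
  then have "set (vwalk_arcs (map f p)) \<subseteq> parcs H"
    by (auto simp: vwalk_arcs_map)
  then show ?thesis
    using assms by (auto simp: vpath_def vwalk_def distinct_map)
qed

text \<open>An arc of the product either projects to an arc of \<open>G\<close> or fixes the first
  coordinate. Dropping the steps of the second kind leaves a walk of \<open>G\<close>.\<close>

lemma vwalk_strong_product_project:
  assumes "vwalk q (with_proj (strong_product G H))"
  shows "\<exists>q'. vwalk q' (with_proj G) \<and> hd q' = fst (hd q) \<and> last q' = fst (last q) \<and>
    length q' \<le> length q"
  using assms
proof (induct q)
  case (Base u)
  then have "vwalk [fst u] (with_proj G)"
    by (auto simp: vwalk_def strong_product_def)
  then show ?case
    by (intro exI[of _ "[fst u]"]) simp
next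
  case (Cons u v es)
  then obtain q' where q': "vwalk q' (with_proj G)" "hd q' = fst v"
      "last q' = fst (last (v # es))" "length q' \<le> length (v # es)"
    by auto
  have u: "fst u \<in> pverts G" and uv: "fst u = fst v \<or> (fst u, fst v) \<in> parcs G"
    using Cons(1) by (auto simp: strong_product_def)
  show ?case
  proof (cases "fst u = fst v")
    case True
    then show ?thesis
      using q' by (intro exI[of _ q']) auto
  next
    case False
    then have "vwalk (fst u # q') (with_proj G)"
      using q' u uv by (intro vwalk_consI) auto
    moreover have "q' \<noteq> []"
      using q'(1) by auto
    ultimately show ?thesis
      using q' by (intro exI[of _ "fst u # q'"]) auto
  qed
qed

lemma visible_arc:
  assumes "(x, y) \<in> parcs G" "x \<in> pverts G" "y \<in> pverts G" "x \<noteq> y"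
  shows "visible G X x y"
proof -
  have "vwalk_length [x, y] \<le> vwalk_length q"
    if "vpath q (with_proj G)" "hd q = x" "last q = y" for q
    using that assms(4) by (cases q rule: vwalk_arcs.cases) auto
  then have "shortest_path G x [x, y] y"
    using assms by (auto simp: shortest_path_def vpath_def vwalk_def)
  then show ?thesis
    by (auto simp: visible_def internal_verts_def)
qed

text \<open>\<open>internal_verts\<close> is defined by position in the list; distinctness keeps the
  end vertices from recurring at inner positions.\<close>

lemma internal_verts_distinct:
  assumes "distinct p" "v \<in> internal_verts p"
  shows "v \<in> set p" "v \<noteq> hd p" "v \<noteq> last p"
proof -
  obtain a r where p: "p = a # r"
    using assms by (cases p) (auto simp: internal_verts_def)
  then have r: "r = butlast r @ [last r]"
    using assms by (cases "r = []") (auto simp: internal_verts_def)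
  have v: "v \<in> set (butlast r)"
    using assms p by (simp add: internal_verts_def)
  then show "v \<in> set p" "v \<noteq> hd p"
    using assms(1) p by (auto dest: in_set_butlastD)
  have "distinct (butlast r @ [last r])"
    using assms(1) p r by simp
  then show "v \<noteq> last p"
    using v p by auto
qed

text \<open>Completeness of \<open>H\<close> lets a lifted path change layers freely at any step.
  Only layer \<open>k\<close> meets its interior, so \<open>X\<close> has to be controlled by
  \<open>S\<close> in that layer alone.\<close>

lemma visible_strong_product_complete:
  assumes vis: "visible G S g h" and "g \<noteq> h"
    and complete: "\<And>i j. i \<in> pverts H \<Longrightarrow> j \<in> pverts H \<Longrightarrow> i \<noteq> j \<Longrightarrow> (i, j) \<in> parcs H"
    and ijk: "i \<in> pverts H" "j \<in> pverts H" "k \<in> pverts H"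
    and X: "\<And>v. (v, k) \<in> X \<Longrightarrow> v \<in> S"
  shows "visible (strong_product G H) X (g, i) (h, j)"
proof -
  obtain p where p: "shortest_path G g p h" and pS: "internal_verts p \<inter> S = {}"
    using vis by (auto simp: visible_def)
  have path: "vpath p (with_proj G)" and ends: "hd p = g" "last p = h"
    using p by (auto simp: shortest_path_def)
  then have "p \<noteq> []" "distinct p"
    by auto
  \<comment> \<open>The lift puts the two ends in their prescribed layers and every other vertex in
    layer \<open>k\<close>. It is injective, with left inverse \<open>fst\<close>.\<close>
  define f where "f v = (v, if v = g then i else if v = h then j else k)" for v
  have layer: "snd (f v) \<in> pverts H" for v
    using ijk by (simp add: f_def)
  have fst_f: "fst (f v) = v" for v
    by (simp add: f_def)
  have verts: "set p \<subseteq> pverts G"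
    using path by (auto simp: vpath_def vwalk_def)
  have "vpath (map f p) (with_proj (strong_product G H))"
  proof (rule vpath_map)
    show "vpath p (with_proj G)"
      by (rule path)
    show "inj_on f (set p)"
      by (rule inj_on_inverseI[of _ fst]) (rule fst_f)
    show "f ` set p \<subseteq> pverts (strong_product G H)"
      using verts layer fst_f by (force simp: strong_product_def mem_Times_iff)
    fix u v
    assume uv: "u \<in> set p" "v \<in> set p" "u \<noteq> v" "(u, v) \<in> parcs G"
    have "snd (f u) = snd (f v) \<or> (snd (f u), snd (f v)) \<in> parcs H"
      using layer[of u] layer[of v] complete by metis
    then have "((u, snd (f u)), (v, snd (f v))) \<in> parcs (strong_product G H)"
      using uv verts layer[of u] layer[of v] by (auto simp: strong_product_def)
    then show "(f u, f v) \<in> parcs (strong_product G H)"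
      by (metis fst_f prod.collapse)
  qed
  moreover have "hd (map f p) = (g, i)" "last (map f p) = (h, j)"
    using \<open>p \<noteq> []\<close> ends \<open>g \<noteq> h\<close> by (auto simp: hd_map last_map f_def)
  moreover have "vwalk_length (map f p) \<le> vwalk_length q"
    if q: "vpath q (with_proj (strong_product G H))" "hd q = (g, i)" "last q = (h, j)" for q
  proof -
    obtain q' where "vwalk q' (with_proj G)" "hd q' = g" "last q' = h" "length q' \<le> length q"
      using vwalk_strong_product_project[of q G H] q by (auto simp: vpath_def)
    then show ?thesis
      using shortest_path_le_vwalk[OF p, of q'] by simp
  qed
  ultimately have "shortest_path (strong_product G H) (g, i) (map f p) (h, j)"
    unfolding shortest_path_def by blast
  moreover have "internal_verts (map f p) \<inter> X = {}"
  proof -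
    have "internal_verts (map f p) = f ` internal_verts p"
      by (simp add: internal_verts_def map_tl[symmetric] map_butlast[symmetric])
    \<comment> \<open>An internal vertex differs from \<open>g\<close> and \<open>h\<close>, so
      \<open>f\<close> sends it to layer \<open>k\<close>, where \<open>X\<close> contains only
      vertices over \<open>S\<close>.\<close>
    moreover have "f v \<notin> X" if "v \<in> internal_verts p" for v
      using that internal_verts_distinct[OF \<open>distinct p\<close> that] ends pS X by (auto simp: f_def)
    ultimately show ?thesis
      by auto
  qed
  ultimately show ?thesis
    unfolding visible_def by blast
qed

lemma mutual_visibility_set_strong_product_complete:
  assumes S: "total_mutual_visibility_set G S" and "k \<in> pverts H"
    and complete: "\<And>i j. i \<in> pverts H \<Longrightarrow> j \<in> pverts H \<Longrightarrow> i \<noteq> j \<Longrightarrow> (i, j) \<in> parcs H"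
  shows "mutual_visibility_set (strong_product G H) (S \<times> {k} \<union> pverts G \<times> (pverts H - {k}))"
    (is "mutual_visibility_set _ ?X")
proof -
  have X: "?X \<subseteq> pverts G \<times> pverts H"
    using S \<open>k \<in> pverts H\<close> by (auto simp: total_mutual_visibility_set_def)
  have "visible (strong_product G H) ?X (g, i) (h, j)"
    if "(g, i) \<in> ?X" "(h, j) \<in> ?X" "(g, i) \<noteq> (h, j)" for g i h j
  proof -
    have mem: "g \<in> pverts G" "h \<in> pverts G" "i \<in> pverts H" "j \<in> pverts H"
      using that X by auto
    show ?thesis
    proof (cases "g = h")
      \<comment> \<open>Two vertices over the same vertex of \<open>G\<close> are adjacent, as
        \<open>H\<close> is complete.\<close>
      case True
      then show ?thesis
        using mem that(3) complete by (intro visible_arc) (auto simp: strong_product_def)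
    next
      case False
      \<comment> \<open>Here \<open>g\<close> and \<open>h\<close> may lie outside \<open>S\<close>,
        because the layers other than \<open>k\<close> are taken whole; hence total
        mutual-visibility is used.\<close>
      then have "visible G S g h"
        using S mem by (simp add: total_mutual_visibility_set_def pairwise_def)
      then show ?thesis
        using False complete mem(3,4) \<open>k \<in> pverts H\<close>
        by (rule visible_strong_product_complete) auto
    qed
  qed
  then have "pairwise (visible (strong_product G H) ?X) ?X"
    unfolding pairwise_def by (metis surj_pair)
  then show ?thesis
    using X by (simp add: mutual_visibility_set_def strong_product_def)
qed

lemma card_le_mu:
  assumes "finite (pverts G)" "mutual_visibility_set G X"
  shows "card X \<le> mu G"
proof -
  have "{card X |X. mutual_visibility_set G X} \<subseteq> card ` Pow (pverts G)"
    by (auto simp: mutual_visibility_set_def)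
  then have "finite {card X |X. mutual_visibility_set G X}"
    using assms(1) by (meson finite_Pow_iff finite_imageI finite_subset)
  then show ?thesis
    unfolding mu_def using assms(2) by (intro Max_ge) auto
qed

theorem theorem5p2:
  fixes G :: "'a pair_pre_digraph"
  assumes "pair_graph G"
    and "Digraph_Component.connected (with_proj G)"
    and "mu_mu_t_graph G"
    and "\<exists>S. mu_t_set G S \<and> feasible G S"
  shows "mu (strong_product G (path_graph 2)) \<ge> mu G + card (pverts G)"
proof -
  interpret pair_graph G
    by (rule assms(1))
  obtain S where S: "total_mutual_visibility_set G S" "card S = mu G"
    using assms(3,4) by (auto simp: mu_t_set_def mu_mu_t_graph_def)
  have "finite S"
    using S(1) finite_subset[OF _ pair_finite_verts] by (simp add: total_mutual_visibility_set_def)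
  let ?P = "path_graph 2"
  \<comment> \<open>The path on two vertices is complete, with vertices 0 and 1. With
    \<open>k = 1\<close> the only full layer is that of 0, which contributes the summand
    \<open>card (pverts G)\<close>.\<close>
  let ?X = "S \<times> {1} \<union> pverts G \<times> (pverts ?P - {1})"
  have "mutual_visibility_set (strong_product G ?P) ?X"
    by (rule mutual_visibility_set_strong_product_complete[OF S(1)]) (auto simp: path_graph_def)
  moreover have "finite (pverts (strong_product G ?P))"
    using pair_finite_verts by (simp add: strong_product_def path_graph_def)
  ultimately have "card ?X \<le> mu (strong_product G ?P)"
    by (rule card_le_mu[rotated])
  moreover have "pverts ?P - {1} = {0}"
    by (auto simp: path_graph_def)
  then have "card ?X = card S + card (pverts G)"
    using \<open>finite S\<close> pair_finite_verts by (simp only:) (subst card_Un_disjoint; auto)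
  ultimately show ?thesis
    using S(2) by simp
qed

end
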